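(* The map $\rho\colon\Lambda(\mathsf{MS4})\to\Lambda(\mathsf{MIPC})$, $\rho\mathsf M=\{\varphi:\mathsf M\vdash\varphi^t\}$, is neither a lattice homomorphism nor one-to-one.
   Context: $\mathcal L_{\forall\exists}$ is the propositional language with connectives $\bot,\wedge,\vee,\to$ (and $\neg\varphi=\varphi\to\bot$) and two unary modalities $\forall,\exists$. $\mathsf{MIPC}$ is the smallest set of $\mathcal L_{\forall\exists}$-formulas containing all theorems of the intuitionistic propositional calculus and the formulas $\forall(p\land q)\leftrightarrow(\forall p\land\forall q)$, $\forall p\to p$, $\forall p\to\forall\forall p$, $\exists(p\vee q)\leftrightarrow(\exists p\vee\exists q)$, $p\to\exists p$, $\exists\exists p\to\exists p$, $(\exists p\land\exists q)\to\exists(\exists p\land q)$, $\exists\forall p\leftrightarrow\forall p$, $\exists p\leftrightarrow\forall\exists p$, and closed under modus ponens, substitution, and necessitation $\varphi/\forall\varphi$. An extension of $\mathsf{MIPC}$ is a set of $\mathcal L_{\forall\exists}$-formulas containing $\mathsf{MIPC}$ and closed under the same rules. $\Lambda(\mathsf{MIPC})$ is the complete lattice of extensions of $\mathsf{MIPC}$ ordered by inclusion (meets are intersections; the join is the least extension containing the union). $\mathcal L_{\Box\forall}$ is the classical propositional modal language with two unary modalities $\Box,\forall$; $\exists$ abbreviates $\neg\forall\neg$. $\mathsf{MS4}$ is the smallest set of $\mathcal L_{\Box\forall}$-formulas containing all theorems of classical propositional calculus, the $\mathsf{S4}$-axioms for $\Box$, the $\mathsf{S5}$-axioms for $\forall$,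 the axiom $\Box\forall p\to\forall\Box p$, and closed under modus ponens, substitution, $\Box$-necessitation and $\forall$-necessitation. Extensions of $\mathsf{MS4}$ are sets of $\mathcal L_{\Box\forall}$-formulas containing $\mathsf{MS4}$ and closed under these rules; $\Lambda(\mathsf{MS4})$ is the complete lattice of these under inclusion. $\mathsf M\vdash\varphi$ means $\varphi\in\mathsf M$. The Gödel translation $(-)^t$ from $\mathcal L_{\forall\exists}$-formulas to $\mathcal L_{\Box\forall}$-formulas: $\bot^t=\bot$, $p^t=\Box p$ for propositional letters $p$, $(\varphi\land\psi)^t=\varphi^t\land\psi^t$, $(\varphi\lor\psi)^t=\varphi^t\lor\psi^t$, $(\varphi\to\psi)^t=\Box(\neg\varphi^t\lor\psi^t)$, $(\forall\varphi)^t=\Box\forall\varphi^t$, $(\exists\varphi)^t=\exists\varphi^t$. In $\rho\mathsf M$, $\varphi$ ranges over $\mathcal L_{\forall\exists}$-formulas. *)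

theory Defs
  imports "HOL-Algebra.Complete_Lattice"
begin

section \<open>The language of monadic intuitionistic logic and \<open>MIPC\<close>\<close>

datatype iform =
    IVar nat
  | IBot (\<open>\<^bold>\<bottom>\<^sub>i\<close>)
  | IAnd iform iform (infixr \<open>\<^bold>\<and>\<^sub>i\<close> 75)
  | IOr iform iform (infixr \<open>\<^bold>\<or>\<^sub>i\<close> 70)
  | IImp iform iform (infixr \<open>\<^bold>\<rightarrow>\<^sub>i\<close> 65)
  | IAll iform (\<open>\<^bold>\<forall>\<^sub>i _\<close> [80] 80)
  | IEx iform (\<open>\<^bold>\<exists>\<^sub>i _\<close> [80] 80)

abbreviation IIff :: "iform \<Rightarrow> iform \<Rightarrow> iform" (infix \<open>\<^bold>\<leftrightarrow>\<^sub>i\<close> 60) where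
  "\<phi> \<^bold>\<leftrightarrow>\<^sub>i \<psi> \<equiv> (\<phi> \<^bold>\<rightarrow>\<^sub>i \<psi>) \<^bold>\<and>\<^sub>i (\<psi> \<^bold>\<rightarrow>\<^sub>i \<phi>)"

primrec isubst :: "(nat \<Rightarrow> iform) \<Rightarrow> iform \<Rightarrow> iform" where
  "isubst \<sigma> (IVar n) = \<sigma> n"
| "isubst \<sigma> \<^bold>\<bottom>\<^sub>i = \<^bold>\<bottom>\<^sub>i"
| "isubst \<sigma> (\<phi> \<^bold>\<and>\<^sub>i \<psi>) = isubst \<sigma> \<phi> \<^bold>\<and>\<^sub>i isubst \<sigma> \<psi>"
| "isubst \<sigma> (\<phi> \<^bold>\<or>\<^sub>i \<psi>) = isubst \<sigma> \<phi> \<^bold>\<or>\<^sub>i isubst \<sigma> \<psi>"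
| "isubst \<sigma> (\<phi> \<^bold>\<rightarrow>\<^sub>i \<psi>) = isubst \<sigma> \<phi> \<^bold>\<rightarrow>\<^sub>i isubst \<sigma> \<psi>"
| "isubst \<sigma> (\<^bold>\<forall>\<^sub>i \<phi>) = \<^bold>\<forall>\<^sub>i (isubst \<sigma> \<phi>)"
| "isubst \<sigma> (\<^bold>\<exists>\<^sub>i \<phi>) = \<^bold>\<exists>\<^sub>i (isubst \<sigma> \<phi>)"

text \<open>Theorems of the intuitionistic propositional calculus.  The axioms are schemas
  over the full language, so modalised formulas occur in them as atoms; since \<open>MIPC\<close>
  is closed under substitution, this yields the same logic as starting from
  modality-free theorems only.\<close>

inductive_set IPC :: "iform set" where
  "\<phi> \<^bold>\<rightarrow>\<^sub>i \<psi> \<^bold>\<rightarrow>\<^sub>i \<phi> \<in> IPC"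
| "(\<phi> \<^bold>\<rightarrow>\<^sub>i \<psi> \<^bold>\<rightarrow>\<^sub>i \<chi>) \<^bold>\<rightarrow>\<^sub>i (\<phi> \<^bold>\<rightarrow>\<^sub>i \<psi>) \<^bold>\<rightarrow>\<^sub>i \<phi> \<^bold>\<rightarrow>\<^sub>i \<chi> \<in> IPC"
| "\<phi> \<^bold>\<and>\<^sub>i \<psi> \<^bold>\<rightarrow>\<^sub>i \<phi> \<in> IPC"
| "\<phi> \<^bold>\<and>\<^sub>i \<psi> \<^bold>\<rightarrow>\<^sub>i \<psi> \<in> IPC"
| "\<phi> \<^bold>\<rightarrow>\<^sub>i \<psi> \<^bold>\<rightarrow>\<^sub>i \<phi> \<^bold>\<and>\<^sub>i \<psi> \<in> IPC"
| "\<phi> \<^bold>\<rightarrow>\<^sub>i \<phi> \<^bold>\<or>\<^sub>i \<psi> \<in> IPC"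
| "\<psi> \<^bold>\<rightarrow>\<^sub>i \<phi> \<^bold>\<or>\<^sub>i \<psi> \<in> IPC"
| "(\<phi> \<^bold>\<rightarrow>\<^sub>i \<chi>) \<^bold>\<rightarrow>\<^sub>i (\<psi> \<^bold>\<rightarrow>\<^sub>i \<chi>) \<^bold>\<rightarrow>\<^sub>i \<phi> \<^bold>\<or>\<^sub>i \<psi> \<^bold>\<rightarrow>\<^sub>i \<chi> \<in> IPC"
| "\<^bold>\<bottom>\<^sub>i \<^bold>\<rightarrow>\<^sub>i \<phi> \<in> IPC"
| "\<phi> \<in> IPC \<Longrightarrow> \<phi> \<^bold>\<rightarrow>\<^sub>i \<psi> \<in> IPC \<Longrightarrow> \<psi> \<in> IPC"

definition MIPC_axioms :: "iform set" where
  "MIPC_axioms = (let p = IVar 0; q = IVar 1 in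
    {\<^bold>\<forall>\<^sub>i (p \<^bold>\<and>\<^sub>i q) \<^bold>\<leftrightarrow>\<^sub>i (\<^bold>\<forall>\<^sub>i p \<^bold>\<and>\<^sub>i \<^bold>\<forall>\<^sub>i q),
     \<^bold>\<forall>\<^sub>i p \<^bold>\<rightarrow>\<^sub>i p,
     \<^bold>\<forall>\<^sub>i p \<^bold>\<rightarrow>\<^sub>i \<^bold>\<forall>\<^sub>i (\<^bold>\<forall>\<^sub>i p),
     \<^bold>\<exists>\<^sub>i (p \<^bold>\<or>\<^sub>i q) \<^bold>\<leftrightarrow>\<^sub>i (\<^bold>\<exists>\<^sub>i p \<^bold>\<or>\<^sub>i \<^bold>\<exists>\<^sub>i q),
     p \<^bold>\<rightarrow>\<^sub>i \<^bold>\<exists>\<^sub>i p,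
     \<^bold>\<exists>\<^sub>i (\<^bold>\<exists>\<^sub>i p) \<^bold>\<rightarrow>\<^sub>i \<^bold>\<exists>\<^sub>i p,
     (\<^bold>\<exists>\<^sub>i p \<^bold>\<and>\<^sub>i \<^bold>\<exists>\<^sub>i q) \<^bold>\<rightarrow>\<^sub>i \<^bold>\<exists>\<^sub>i (\<^bold>\<exists>\<^sub>i p \<^bold>\<and>\<^sub>i q),
     \<^bold>\<exists>\<^sub>i (\<^bold>\<forall>\<^sub>i p) \<^bold>\<leftrightarrow>\<^sub>i \<^bold>\<forall>\<^sub>i p,
     \<^bold>\<exists>\<^sub>i p \<^bold>\<leftrightarrow>\<^sub>i \<^bold>\<forall>\<^sub>i (\<^bold>\<exists>\<^sub>i p)})"

definition iclosed :: "iform set \<Rightarrow> bool" where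
  "iclosed L \<longleftrightarrow>
     (\<forall>\<phi> \<psi>. \<phi> \<in> L \<longrightarrow> \<phi> \<^bold>\<rightarrow>\<^sub>i \<psi> \<in> L \<longrightarrow> \<psi> \<in> L) \<and>
     (\<forall>\<phi> \<sigma>. \<phi> \<in> L \<longrightarrow> isubst \<sigma> \<phi> \<in> L) \<and>
     (\<forall>\<phi>. \<phi> \<in> L \<longrightarrow> \<^bold>\<forall>\<^sub>i \<phi> \<in> L)"

definition MIPC :: "iform set" where
  "MIPC = \<Inter>{L. IPC \<subseteq> L \<and> MIPC_axioms \<subseteq> L \<and> iclosed L}"

definition Ext_MIPC :: "iform set gorder" where
  "Ext_MIPC = \<lparr>carrier = {L. MIPC \<subseteq> L \<and> iclosed L}, eq = (=), le = (\<subseteq>)\<rparr>"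


section \<open>The classical bimodal language and \<open>MS4\<close>\<close>

datatype mform =
    MVar nat
  | MBot (\<open>\<^bold>\<bottom>\<^sub>m\<close>)
  | MAnd mform mform (infixr \<open>\<^bold>\<and>\<^sub>m\<close> 75)
  | MOr mform mform (infixr \<open>\<^bold>\<or>\<^sub>m\<close> 70)
  | MImp mform mform (infixr \<open>\<^bold>\<rightarrow>\<^sub>m\<close> 65)
  | MBox mform (\<open>\<^bold>\<box>\<^sub>m _\<close> [80] 80)
  | MAll mform (\<open>\<^bold>\<forall>\<^sub>m _\<close> [80] 80)

abbreviation MNot :: "mform \<Rightarrow> mform" (\<open>\<^bold>\<not>\<^sub>m _\<close> [80] 80) where
  "\<^bold>\<not>\<^sub>m \<phi> \<equiv> \<phi> \<^bold>\<rightarrow>\<^sub>m \<^bold>\<bottom>\<^sub>m"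

abbreviation MEx :: "mform \<Rightarrow> mform" (\<open>\<^bold>\<exists>\<^sub>m _\<close> [80] 80) where
  "\<^bold>\<exists>\<^sub>m \<phi> \<equiv> \<^bold>\<not>\<^sub>m (\<^bold>\<forall>\<^sub>m (\<^bold>\<not>\<^sub>m \<phi>))"

primrec msubst :: "(nat \<Rightarrow> mform) \<Rightarrow> mform \<Rightarrow> mform" where
  "msubst \<sigma> (MVar n) = \<sigma> n"
| "msubst \<sigma> \<^bold>\<bottom>\<^sub>m = \<^bold>\<bottom>\<^sub>m"
| "msubst \<sigma> (\<phi> \<^bold>\<and>\<^sub>m \<psi>) = msubst \<sigma> \<phi> \<^bold>\<and>\<^sub>m msubst \<sigma> \<psi>"
| "msubst \<sigma> (\<phi> \<^bold>\<or>\<^sub>m \<psi>) = msubst \<sigma> \<phi> \<^bold>\<or>\<^sub>m msubst \<sigma> \<psi>"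
| "msubst \<sigma> (\<phi> \<^bold>\<rightarrow>\<^sub>m \<psi>) = msubst \<sigma> \<phi> \<^bold>\<rightarrow>\<^sub>m msubst \<sigma> \<psi>"
| "msubst \<sigma> (\<^bold>\<box>\<^sub>m \<phi>) = \<^bold>\<box>\<^sub>m (msubst \<sigma> \<phi>)"
| "msubst \<sigma> (\<^bold>\<forall>\<^sub>m \<phi>) = \<^bold>\<forall>\<^sub>m (msubst \<sigma> \<phi>)"

inductive_set CPC :: "mform set" where
  "\<phi> \<^bold>\<rightarrow>\<^sub>m \<psi> \<^bold>\<rightarrow>\<^sub>m \<phi> \<in> CPC"
| "(\<phi> \<^bold>\<rightarrow>\<^sub>m \<psi> \<^bold>\<rightarrow>\<^sub>m \<chi>) \<^bold>\<rightarrow>\<^sub>m (\<phi> \<^bold>\<rightarrow>\<^sub>m \<psi>) \<^bold>\<rightarrow>\<^sub>m \<phi> \<^bold>\<rightarrow>\<^sub>m \<chi> \<in> CPC"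
| "\<phi> \<^bold>\<and>\<^sub>m \<psi> \<^bold>\<rightarrow>\<^sub>m \<phi> \<in> CPC"
| "\<phi> \<^bold>\<and>\<^sub>m \<psi> \<^bold>\<rightarrow>\<^sub>m \<psi> \<in> CPC"
| "\<phi> \<^bold>\<rightarrow>\<^sub>m \<psi> \<^bold>\<rightarrow>\<^sub>m \<phi> \<^bold>\<and>\<^sub>m \<psi> \<in> CPC"
| "\<phi> \<^bold>\<rightarrow>\<^sub>m \<phi> \<^bold>\<or>\<^sub>m \<psi> \<in> CPC"
| "\<psi> \<^bold>\<rightarrow>\<^sub>m \<phi> \<^bold>\<or>\<^sub>m \<psi> \<in> CPC"
| "(\<phi> \<^bold>\<rightarrow>\<^sub>m \<chi>) \<^bold>\<rightarrow>\<^sub>m (\<psi> \<^bold>\<rightarrow>\<^sub>m \<chi>) \<^bold>\<rightarrow>\<^sub>m \<phi> \<^bold>\<or>\<^sub>m \<psi> \<^bold>\<rightarrow>\<^sub>m \<chi> \<in> CPC"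
| "\<^bold>\<not>\<^sub>m (\<^bold>\<not>\<^sub>m \<phi>) \<^bold>\<rightarrow>\<^sub>m \<phi> \<in> CPC"
| "\<phi> \<in> CPC \<Longrightarrow> \<phi> \<^bold>\<rightarrow>\<^sub>m \<psi> \<in> CPC \<Longrightarrow> \<psi> \<in> CPC"

definition S4_box_axioms :: "mform set" where
  "S4_box_axioms = (let p = MVar 0; q = MVar 1 in
    {\<^bold>\<box>\<^sub>m (p \<^bold>\<rightarrow>\<^sub>m q) \<^bold>\<rightarrow>\<^sub>m \<^bold>\<box>\<^sub>m p \<^bold>\<rightarrow>\<^sub>m \<^bold>\<box>\<^sub>m q,
     \<^bold>\<box>\<^sub>m p \<^bold>\<rightarrow>\<^sub>m p,
     \<^bold>\<box>\<^sub>m p \<^bold>\<rightarrow>\<^sub>m \<^bold>\<box>\<^sub>m (\<^bold>\<box>\<^sub>m p)})"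

definition S5_all_axioms :: "mform set" where
  "S5_all_axioms = (let p = MVar 0; q = MVar 1 in
    {\<^bold>\<forall>\<^sub>m (p \<^bold>\<rightarrow>\<^sub>m q) \<^bold>\<rightarrow>\<^sub>m \<^bold>\<forall>\<^sub>m p \<^bold>\<rightarrow>\<^sub>m \<^bold>\<forall>\<^sub>m q,
     \<^bold>\<forall>\<^sub>m p \<^bold>\<rightarrow>\<^sub>m p,
     \<^bold>\<forall>\<^sub>m p \<^bold>\<rightarrow>\<^sub>m \<^bold>\<forall>\<^sub>m (\<^bold>\<forall>\<^sub>m p),
     \<^bold>\<exists>\<^sub>m p \<^bold>\<rightarrow>\<^sub>m \<^bold>\<forall>\<^sub>m (\<^bold>\<exists>\<^sub>m p)})"

definition MS4_axioms :: "mform set" where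
  "MS4_axioms = S4_box_axioms \<union> S5_all_axioms \<union>
    {\<^bold>\<box>\<^sub>m (\<^bold>\<forall>\<^sub>m (MVar 0)) \<^bold>\<rightarrow>\<^sub>m \<^bold>\<forall>\<^sub>m (\<^bold>\<box>\<^sub>m (MVar 0))}"

definition mclosed :: "mform set \<Rightarrow> bool" where
  "mclosed L \<longleftrightarrow>
     (\<forall>\<phi> \<psi>. \<phi> \<in> L \<longrightarrow> \<phi> \<^bold>\<rightarrow>\<^sub>m \<psi> \<in> L \<longrightarrow> \<psi> \<in> L) \<and>
     (\<forall>\<phi> \<sigma>. \<phi> \<in> L \<longrightarrow> msubst \<sigma> \<phi> \<in> L) \<and>
     (\<forall>\<phi>. \<phi> \<in> L \<longrightarrow> \<^bold>\<box>\<^sub>m \<phi> \<in> L) \<and>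
     (\<forall>\<phi>. \<phi> \<in> L \<longrightarrow> \<^bold>\<forall>\<^sub>m \<phi> \<in> L)"

definition MS4 :: "mform set" where
  "MS4 = \<Inter>{L. CPC \<subseteq> L \<and> MS4_axioms \<subseteq> L \<and> mclosed L}"

definition Ext_MS4 :: "mform set gorder" where
  "Ext_MS4 = \<lparr>carrier = {L. MS4 \<subseteq> L \<and> mclosed L}, eq = (=), le = (\<subseteq>)\<rparr>"


section \<open>The lattices of extensions\<close>

lemma closure_system_complete_lattice:
  assumes top: "UNIV \<in> C"
    and Int: "\<And>A. A \<subseteq> C \<Longrightarrow> A \<noteq> {} \<Longrightarrow> \<Inter>A \<in> C"
  shows "complete_lattice \<lparr>carrier = C, eq = (=), le = (\<subseteq>)\<rparr>"
proof -
  let ?L = "\<lparr>carrier = C, eq = (=), le = (\<subseteq>)\<rparr>"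
  interpret partial_order ?L
    by unfold_locales auto
  show ?thesis
  proof (rule complete_lattice_criterion1)
    show "\<exists>g. greatest ?L g (carrier ?L)"
      using top by (auto simp: greatest_def intro!: exI[of _ UNIV])
  next
    fix A assume A: "A \<subseteq> carrier ?L" "A \<noteq> {}"
    then have "greatest ?L (\<Inter>A) (Lower ?L A)"
      using Int[of A] by (auto simp: greatest_def Lower_def)
    then show "\<exists>i. greatest ?L i (Lower ?L A)" ..
  qed
qed

lemma complete_lattice_Ext_MIPC: "complete_lattice Ext_MIPC"
  unfolding Ext_MIPC_def
proof (rule closure_system_complete_lattice)
  show "UNIV \<in> {L. MIPC \<subseteq> L \<and> iclosed L}"
    by (simp add: iclosed_def)
next
  fix A assume A: "A \<subseteq> {L. MIPC \<subseteq> L \<and> iclosed L}" "A \<noteq> {}"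
  then have "MIPC \<subseteq> \<Inter>A"
    by blast
  moreover have "iclosed L" if "L \<in> A" for L
    using A that by blast
  then have "iclosed (\<Inter>A)"
    unfolding iclosed_def by (meson Inter_iff)
  ultimately show "\<Inter>A \<in> {L. MIPC \<subseteq> L \<and> iclosed L}"
    by simp
qed

lemma complete_lattice_Ext_MS4: "complete_lattice Ext_MS4"
  unfolding Ext_MS4_def
proof (rule closure_system_complete_lattice)
  show "UNIV \<in> {L. MS4 \<subseteq> L \<and> mclosed L}"
    by (simp add: mclosed_def)
next
  fix A assume A: "A \<subseteq> {L. MS4 \<subseteq> L \<and> mclosed L}" "A \<noteq> {}"
  then have "MS4 \<subseteq> \<Inter>A"
    by blast
  moreover have "mclosed L" if "L \<in> A" for L
    using A that by blast
  then have "mclosed (\<Inter>A)"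
    unfolding mclosed_def by (meson Inter_iff)
  ultimately show "\<Inter>A \<in> {L. MS4 \<subseteq> L \<and> mclosed L}"
    by simp
qed

text \<open>The predicates \<^const>\<open>join_pres\<close> and \<^const>\<open>meet_pres\<close> also require both
  orders to be lattices; for the two orders above this is settled by the preceding lemmas.\<close>

definition lattice_hom ::
    "('a, 'c) gorder_scheme \<Rightarrow> ('b, 'd) gorder_scheme \<Rightarrow> ('a \<Rightarrow> 'b) \<Rightarrow> bool" where
  "lattice_hom X Y f \<longleftrightarrow>
     f \<in> carrier X \<rightarrow> carrier Y \<and> join_pres X Y f \<and> meet_pres X Y f"


section \<open>The Goedel translation\<close>

primrec goedel :: "iform \<Rightarrow> mform" where
  "goedel (IVar n) = \<^bold>\<box>\<^sub>m (MVar n)"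
| "goedel \<^bold>\<bottom>\<^sub>i = \<^bold>\<bottom>\<^sub>m"
| "goedel (\<phi> \<^bold>\<and>\<^sub>i \<psi>) = goedel \<phi> \<^bold>\<and>\<^sub>m goedel \<psi>"
| "goedel (\<phi> \<^bold>\<or>\<^sub>i \<psi>) = goedel \<phi> \<^bold>\<or>\<^sub>m goedel \<psi>"
| "goedel (\<phi> \<^bold>\<rightarrow>\<^sub>i \<psi>) = \<^bold>\<box>\<^sub>m (\<^bold>\<not>\<^sub>m (goedel \<phi>) \<^bold>\<or>\<^sub>m goedel \<psi>)"
| "goedel (\<^bold>\<forall>\<^sub>i \<phi>) = \<^bold>\<box>\<^sub>m (\<^bold>\<forall>\<^sub>m (goedel \<phi>))"
| "goedel (\<^bold>\<exists>\<^sub>i \<phi>) = \<^bold>\<exists>\<^sub>m (goedel \<phi>)"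

definition rho :: "mform set \<Rightarrow> iform set" where
  "rho M = {\<phi>. goedel \<phi> \<in> M}"

end

theory Submission
  imports Defs
begin

text \<open>
  Write \<open>\<phi>\<^sup>t\<close> for the Goedel translation.  In a Kripke frame for \<open>MS4\<close> every \<open>\<phi>\<^sup>t\<close>
  denotes an up-set of the quasi-order \<open>R\<close> that interprets \<open>\<box>\<close>, so \<open>\<rho>\<close> of the logic of the frame
  depends only on the algebra of up-sets with the two quantifiers.  Clusters of \<open>R\<close> are
  invisible there.  For \<open>S4\<close> alone this is harmless, since collapsing clusters is a p-morphism.
  With the equivalence relation \<open>E\<close> for \<open>\<forall>\<close> present it need not be one: different points of a cluster
  may have different \<open>E\<close>-neighbours.

  Both failures come from one pair of frames.  The first is the two-element chain with total
  \<open>E\<close>.  The second is obtained from it by doubling the top point; one copy stays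
  \<open>E\<close>-equivalent to the root, the other is alone in its \<open>E\<close>-class.  Collapsing the
  cluster preserves the truth of all \<open>\<phi>\<^sup>t\<close> (\<open>msat_goedel\<close>), so the two logics have
  the same image under \<open>\<rho>\<close>, and this image lacks excluded middle.  The logics are different: the chain
  validates \<open>\<forall>p \<rightarrow> \<box>p\<close>, the doubled chain does not; so \<open>\<rho>\<close> is not one-to-one.  The doubled chain
  validates \<open>\<diamond>(p \<rightarrow> \<forall>p)\<close>, as each of its points sees the isolated one.  These two
  schemas together derive the translation of excluded middle (\<open>excluded_middle_rho\<close>), so \<open>\<rho>\<close> of the
  join of the two logics contains it, while the join of their equal images does not:
  \<open>\<rho>\<close> does not preserve joins.

  That \<open>\<rho>\<close> maps extensions of \<open>MS4\<close> to extensions of \<open>MIPC\<close> is shown for all extensions,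
  Kripke complete or not, in the canonical frame of the extension, whose points are its complete
  theories.  There membership of \<open>\<phi>\<^sup>t\<close> in a point behaves like intuitionistic forcing.
\<close>

section \<open>Complete classical theories\<close>

definition classical_theory :: "mform set \<Rightarrow> bool" where
  "classical_theory T \<longleftrightarrow>
     CPC \<subseteq> T \<and> (\<forall>\<phi> \<psi>. \<phi> \<in> T \<longrightarrow> \<phi> \<^bold>\<rightarrow>\<^sub>m \<psi> \<in> T \<longrightarrow> \<psi> \<in> T)"

definition complete_theory :: "mform set \<Rightarrow> bool" where
  "complete_theory w \<longleftrightarrow>
     classical_theory w \<and> \<^bold>\<bottom>\<^sub>m \<notin> w \<and> (\<forall>\<phi>. \<phi> \<in> w \<or> \<^bold>\<not>\<^sub>m \<phi> \<in> w)"

lemma classical_theory_mp: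
  "classical_theory T \<Longrightarrow> \<phi> \<^bold>\<rightarrow>\<^sub>m \<psi> \<in> T \<Longrightarrow> \<phi> \<in> T \<Longrightarrow> \<psi> \<in> T"
  unfolding classical_theory_def by blast

lemma classical_theory_CPC: "classical_theory T \<Longrightarrow> \<phi> \<in> CPC \<Longrightarrow> \<phi> \<in> T"
  unfolding classical_theory_def by blast

lemma classical_theory_weaken:
  "classical_theory T \<Longrightarrow> \<psi> \<in> T \<Longrightarrow> \<phi> \<^bold>\<rightarrow>\<^sub>m \<psi> \<in> T"
  by (meson CPC.intros(1) classical_theory_CPC classical_theory_mp)

lemma classical_theory_distrib:
  assumes "classical_theory T" "\<chi> \<^bold>\<rightarrow>\<^sub>m \<phi> \<^bold>\<rightarrow>\<^sub>m \<psi> \<in> T" "\<chi> \<^bold>\<rightarrow>\<^sub>m \<phi> \<in> T"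
  shows "\<chi> \<^bold>\<rightarrow>\<^sub>m \<psi> \<in> T"
  by (meson CPC.intros(2) classical_theory_CPC classical_theory_mp assms)

lemma classical_theory_trans:
  assumes "classical_theory T" "\<phi> \<^bold>\<rightarrow>\<^sub>m \<psi> \<in> T" "\<psi> \<^bold>\<rightarrow>\<^sub>m \<chi> \<in> T"
  shows "\<phi> \<^bold>\<rightarrow>\<^sub>m \<chi> \<in> T"
  using classical_theory_distrib classical_theory_weaken assms by blast

lemma classical_theory_refl:
  assumes "classical_theory T" shows "\<phi> \<^bold>\<rightarrow>\<^sub>m \<phi> \<in> T"
  by (meson CPC.intros(1) classical_theory_CPC classical_theory_distrib assms)

lemma classical_theory_efq:
  assumes "classical_theory T" shows "\<^bold>\<bottom>\<^sub>m \<^bold>\<rightarrow>\<^sub>m \<phi> \<in> T"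
  by (meson CPC.intros(1,9) classical_theory_CPC classical_theory_trans assms)

text \<open>The deduction theorem, in the form in which it is used: the formulas that follow from
  \<open>\<chi>\<close> over a theory form a theory.\<close>

lemma classical_theory_conditional:
  assumes "classical_theory T" shows "classical_theory {\<psi>. \<chi> \<^bold>\<rightarrow>\<^sub>m \<psi> \<in> T}"
  unfolding classical_theory_def
  using classical_theory_weaken[OF assms] classical_theory_CPC[OF assms]
    classical_theory_distrib[OF assms] by blast

text \<open>Over \<open>\<not>\<phi>\<close>, the first implication yields \<open>\<not>\<chi>\<close>, the second then \<open>\<phi>\<close>, a contradiction;
  double negation elimination finishes.\<close>

lemma classical_theory_cases:
  assumes T: "classical_theory T" and "\<chi> \<^bold>\<rightarrow>\<^sub>m \<phi> \<in> T" "\<^bold>\<not>\<^sub>m \<chi> \<^bold>\<rightarrow>\<^sub>m \<phi> \<in> T"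
  shows "\<phi> \<in> T"
proof -
  let ?U = "{\<psi>. \<^bold>\<not>\<^sub>m \<phi> \<^bold>\<rightarrow>\<^sub>m \<psi> \<in> T}"
  have U: "classical_theory ?U" by (rule classical_theory_conditional[OF T])
  have in_U: "\<^bold>\<not>\<^sub>m \<phi> \<in> ?U" "\<chi> \<^bold>\<rightarrow>\<^sub>m \<phi> \<in> ?U" "\<^bold>\<not>\<^sub>m \<chi> \<^bold>\<rightarrow>\<^sub>m \<phi> \<in> ?U"
    using assms by (simp_all add: classical_theory_refl classical_theory_weaken)
  have "\<^bold>\<not>\<^sub>m \<chi> \<in> ?U"
    using classical_theory_trans[OF U in_U(2,1)] .
  then have "\<phi> \<in> ?U"
    using classical_theory_mp[OF U in_U(3)] by blast
  then have "\<^bold>\<bottom>\<^sub>m \<in> ?U"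
    using classical_theory_mp[OF U in_U(1)] by blast
  then show ?thesis
    using T classical_theory_mp classical_theory_CPC CPC.intros(9) by blast
qed

text \<open>A theory \<open>w\<close> maximal among those omitting \<open>\<phi>\<close> is complete: each \<open>\<chi> \<notin> w\<close> implies \<open>\<phi>\<close> over \<open>w\<close>,
  so \<open>w\<close> cannot omit both \<open>\<chi>\<close> and \<open>\<not>\<chi>\<close>.  The theory \<open>T\<close> need not be a modal logic; it will
  also be the set of formulas necessary at a point.\<close>

lemma Lindenbaum:
  assumes T: "classical_theory T" and "\<phi> \<notin> T"
  shows "\<exists>w. complete_theory w \<and> T \<subseteq> w \<and> \<phi> \<notin> w"
proof -
  let ?A = "{U. classical_theory U \<and> T \<subseteq> U \<and> \<phi> \<notin> U}"
  have "\<exists>w\<in>?A. \<forall>U\<in>?A. w \<subseteq> U \<longrightarrow> U = w"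
  proof (rule subset_Zorn_nonempty)
    show "?A \<noteq> {}" using assms by blast
  next
    fix C assume ne: "C \<noteq> {}" and C: "subset.chain ?A C"
    then have sub: "C \<subseteq> ?A" unfolding subset_chain_def by blast
    have "\<psi> \<in> \<Union>C" if "\<chi> \<in> \<Union>C" "\<chi> \<^bold>\<rightarrow>\<^sub>m \<psi> \<in> \<Union>C" for \<chi> \<psi>
    proof -
      obtain U1 U2 where "U1 \<in> C" "\<chi> \<in> U1" "U2 \<in> C" "\<chi> \<^bold>\<rightarrow>\<^sub>m \<psi> \<in> U2"
        using \<open>\<chi> \<in> \<Union>C\<close> \<open>\<chi> \<^bold>\<rightarrow>\<^sub>m \<psi> \<in> \<Union>C\<close> by blast
      moreover have "U1 \<subseteq> U2 \<or> U2 \<subseteq> U1"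
        using C \<open>U1 \<in> C\<close> \<open>U2 \<in> C\<close> unfolding subset_chain_def by blast
      ultimately obtain U where "U \<in> C" "\<chi> \<in> U" "\<chi> \<^bold>\<rightarrow>\<^sub>m \<psi> \<in> U" by blast
      then show ?thesis using sub classical_theory_mp by blast
    qed
    moreover have "CPC \<subseteq> \<Union>C"
      using ne sub unfolding classical_theory_def by blast
    ultimately have "classical_theory (\<Union>C)"
      unfolding classical_theory_def by blast
    then show "\<Union>C \<in> ?A" using ne sub by blast
  qed
  then obtain w where w: "classical_theory w" "T \<subseteq> w" "\<phi> \<notin> w"
    and max: "\<forall>U\<in>?A. w \<subseteq> U \<longrightarrow> U = w"
    by auto
  have out: "\<chi> \<^bold>\<rightarrow>\<^sub>m \<phi> \<in> w" if "\<chi> \<notin> w" for \<chi>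
  proof (rule ccontr)
    let ?U = "{\<psi>. \<chi> \<^bold>\<rightarrow>\<^sub>m \<psi> \<in> w}"
    assume "\<chi> \<^bold>\<rightarrow>\<^sub>m \<phi> \<notin> w"
    moreover have U: "w \<subseteq> ?U" using classical_theory_weaken[OF w(1)] by blast
    ultimately have "?U \<in> ?A"
      using classical_theory_conditional[OF w(1)] w(2) by auto
    then have "?U = w" using max U by simp
    then show False using that classical_theory_refl[OF w(1), of \<chi>] by blast
  qed
  have "\<chi> \<in> w \<or> \<^bold>\<not>\<^sub>m \<chi> \<in> w" for \<chi>
    using out classical_theory_cases[OF w(1)] w(3) by blast
  moreover have "\<^bold>\<bottom>\<^sub>m \<notin> w"
    using w classical_theory_efq classical_theory_mp by blast
  ultimately show ?thesis using w unfolding complete_theory_def by blast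
qed

context
  fixes w assumes w: "complete_theory w"
begin

private lemma th: "classical_theory w"
  using w unfolding complete_theory_def by blast

lemma complete_theory_bot: "\<^bold>\<bottom>\<^sub>m \<notin> w"
  using w unfolding complete_theory_def by blast

lemma complete_theory_imp: "\<phi> \<^bold>\<rightarrow>\<^sub>m \<psi> \<in> w \<longleftrightarrow> (\<phi> \<in> w \<longrightarrow> \<psi> \<in> w)"
proof
  assume "\<phi> \<in> w \<longrightarrow> \<psi> \<in> w"
  then consider "\<psi> \<in> w" | "\<^bold>\<not>\<^sub>m \<phi> \<in> w"
    using w unfolding complete_theory_def by blast
  then show "\<phi> \<^bold>\<rightarrow>\<^sub>m \<psi> \<in> w"
    using th classical_theory_weaken classical_theory_trans classical_theory_efq
    by cases blast+
qed (use th classical_theory_mp in blast)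

lemma complete_theory_and: "\<phi> \<^bold>\<and>\<^sub>m \<psi> \<in> w \<longleftrightarrow> \<phi> \<in> w \<and> \<psi> \<in> w"
  using classical_theory_CPC[OF th CPC.intros(3), of \<phi> \<psi>]
    classical_theory_CPC[OF th CPC.intros(4), of \<phi> \<psi>]
    classical_theory_CPC[OF th CPC.intros(5), of \<phi> \<psi>]
  by (auto simp: complete_theory_imp)

lemma complete_theory_or: "\<phi> \<^bold>\<or>\<^sub>m \<psi> \<in> w \<longleftrightarrow> \<phi> \<in> w \<or> \<psi> \<in> w"
  using classical_theory_CPC[OF th CPC.intros(6), of \<phi> \<psi>]
    classical_theory_CPC[OF th CPC.intros(7), of \<psi> \<phi>]
    classical_theory_CPC[OF th CPC.intros(8), of \<phi> "\<^bold>\<bottom>\<^sub>m" \<psi>] complete_theory_bot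
  by (auto simp: complete_theory_imp)

end

lemmas complete_theory_simps =
  complete_theory_bot complete_theory_imp complete_theory_and complete_theory_or


section \<open>The canonical frame of an extension of \<open>MS4\<close>\<close>

lemma CPC_subset_MS4: "CPC \<subseteq> MS4"
  and axioms_subset_MS4: "MS4_axioms \<subseteq> MS4"
  unfolding MS4_def by blast+

locale MS4_extension =
  fixes M :: "mform set"
  assumes MS4_subset: "MS4 \<subseteq> M"
    and closed: "mclosed M"
begin

lemma mp: "\<phi> \<^bold>\<rightarrow>\<^sub>m \<psi> \<in> M \<Longrightarrow> \<phi> \<in> M \<Longrightarrow> \<psi> \<in> M"
  and subst: "\<phi> \<in> M \<Longrightarrow> msubst \<sigma> \<phi> \<in> M"
  and nec_box: "\<phi> \<in> M \<Longrightarrow> \<^bold>\<box>\<^sub>m \<phi> \<in> M"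
  and nec_all: "\<phi> \<in> M \<Longrightarrow> \<^bold>\<forall>\<^sub>m \<phi> \<in> M"
  using closed unfolding mclosed_def by blast+

lemma classical_theory_M: "classical_theory M"
  unfolding classical_theory_def using CPC_subset_MS4 MS4_subset mp by blast

lemma axiom_instance:
  assumes "\<chi> \<in> MS4_axioms" shows "msubst (\<lambda>n. if n = 0 then \<phi> else \<psi>) \<chi> \<in> M"
  using assms axioms_subset_MS4 MS4_subset subst by blast

lemma box_K: "\<^bold>\<box>\<^sub>m (\<phi> \<^bold>\<rightarrow>\<^sub>m \<psi>) \<^bold>\<rightarrow>\<^sub>m \<^bold>\<box>\<^sub>m \<phi> \<^bold>\<rightarrow>\<^sub>m \<^bold>\<box>\<^sub>m \<psi> \<in> M"
  and box_T: "\<^bold>\<box>\<^sub>m \<phi> \<^bold>\<rightarrow>\<^sub>m \<phi> \<in> M"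
  and box_4: "\<^bold>\<box>\<^sub>m \<phi> \<^bold>\<rightarrow>\<^sub>m \<^bold>\<box>\<^sub>m (\<^bold>\<box>\<^sub>m \<phi>) \<in> M"
  and all_K: "\<^bold>\<forall>\<^sub>m (\<phi> \<^bold>\<rightarrow>\<^sub>m \<psi>) \<^bold>\<rightarrow>\<^sub>m \<^bold>\<forall>\<^sub>m \<phi> \<^bold>\<rightarrow>\<^sub>m \<^bold>\<forall>\<^sub>m \<psi> \<in> M"
  and all_T: "\<^bold>\<forall>\<^sub>m \<phi> \<^bold>\<rightarrow>\<^sub>m \<phi> \<in> M"
  and all_4: "\<^bold>\<forall>\<^sub>m \<phi> \<^bold>\<rightarrow>\<^sub>m \<^bold>\<forall>\<^sub>m (\<^bold>\<forall>\<^sub>m \<phi>) \<in> M"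
  and all_5: "\<^bold>\<exists>\<^sub>m \<phi> \<^bold>\<rightarrow>\<^sub>m \<^bold>\<forall>\<^sub>m (\<^bold>\<exists>\<^sub>m \<phi>) \<in> M"
  and box_all: "\<^bold>\<box>\<^sub>m (\<^bold>\<forall>\<^sub>m \<phi>) \<^bold>\<rightarrow>\<^sub>m \<^bold>\<forall>\<^sub>m (\<^bold>\<box>\<^sub>m \<phi>) \<in> M"
  using axiom_instance[of _ \<phi> \<psi>]
  unfolding MS4_axioms_def S4_box_axioms_def S5_all_axioms_def
  by (force simp: Let_def)+

definition W :: "mform set set" where
  "W = {w. complete_theory w \<and> M \<subseteq> w}"

definition R :: "mform set \<Rightarrow> mform set \<Rightarrow> bool" where
  "R w v \<longleftrightarrow> w \<in> W \<and> v \<in> W \<and> (\<forall>\<phi>. \<^bold>\<box>\<^sub>m \<phi> \<in> w \<longrightarrow> \<phi> \<in> v)"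

definition E :: "mform set \<Rightarrow> mform set \<Rightarrow> bool" where
  "E w v \<longleftrightarrow> w \<in> W \<and> v \<in> W \<and> (\<forall>\<phi>. \<^bold>\<forall>\<^sub>m \<phi> \<in> w \<longrightarrow> \<phi> \<in> v)"

lemma W_complete: "w \<in> W \<Longrightarrow> complete_theory w"
  and W_theorem: "w \<in> W \<Longrightarrow> \<phi> \<in> M \<Longrightarrow> \<phi> \<in> w"
  and R_W: "R w v \<Longrightarrow> w \<in> W" "R w v \<Longrightarrow> v \<in> W"
  and E_W: "E w v \<Longrightarrow> w \<in> W" "E w v \<Longrightarrow> v \<in> W"
  unfolding W_def R_def E_def by blast+

lemmas W_simps [simp] = complete_theory_simps[OF W_complete]

lemma W_mp: "\<phi> \<^bold>\<rightarrow>\<^sub>m \<psi> \<in> M \<Longrightarrow> w \<in> W \<Longrightarrow> \<phi> \<in> w \<Longrightarrow> \<psi> \<in> w"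
  using W_theorem W_simps(2) by blast

lemma theoremI:
  assumes "\<And>w. w \<in> W \<Longrightarrow> \<phi> \<in> w" shows "\<phi> \<in> M"
  using Lindenbaum[OF classical_theory_M] assms unfolding W_def by blast

text \<open>The truth lemma, once for both modalities: the formulas necessary at \<open>w\<close> form a theory, and a
  complete extension of it omitting \<open>\<phi>\<close> is a point accessible from \<open>w\<close> that refutes \<open>\<phi>\<close>.\<close>

lemma normal_modality_iff:
  assumes N_K: "\<And>\<phi> \<psi>. N (\<phi> \<^bold>\<rightarrow>\<^sub>m \<psi>) \<^bold>\<rightarrow>\<^sub>m N \<phi> \<^bold>\<rightarrow>\<^sub>m N \<psi> \<in> M"
    and N_nec: "\<And>\<phi>. \<phi> \<in> M \<Longrightarrow> N \<phi> \<in> M" and w: "w \<in> W"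
  shows "N \<phi> \<in> w \<longleftrightarrow> (\<forall>v\<in>W. (\<forall>\<psi>. N \<psi> \<in> w \<longrightarrow> \<psi> \<in> v) \<longrightarrow> \<phi> \<in> v)"
proof
  let ?T = "{\<psi>. N \<psi> \<in> w}"
  have sub: "M \<subseteq> ?T" using N_nec W_theorem[OF w] by blast
  moreover have "\<psi> \<in> ?T" if "\<chi> \<in> ?T" "\<chi> \<^bold>\<rightarrow>\<^sub>m \<psi> \<in> ?T" for \<chi> \<psi>
    using that W_mp[OF N_K w, of \<chi> \<psi>] w by simp
  ultimately have T: "classical_theory ?T"
    using classical_theory_M unfolding classical_theory_def by blast
  assume R: "\<forall>v\<in>W. (\<forall>\<psi>. N \<psi> \<in> w \<longrightarrow> \<psi> \<in> v) \<longrightarrow> \<phi> \<in> v"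
  show "N \<phi> \<in> w"
  proof (rule ccontr)
    assume "N \<phi> \<notin> w"
    then obtain v where "complete_theory v" "?T \<subseteq> v" "\<phi> \<notin> v"
      using Lindenbaum[OF T] by blast
    then show False using R sub unfolding W_def by blast
  qed
qed blast

lemma box_iff: "w \<in> W \<Longrightarrow> \<^bold>\<box>\<^sub>m \<phi> \<in> w \<longleftrightarrow> (\<forall>v. R w v \<longrightarrow> \<phi> \<in> v)"
  using normal_modality_iff[of MBox, OF box_K nec_box] unfolding R_def by blast

lemma all_iff: "w \<in> W \<Longrightarrow> \<^bold>\<forall>\<^sub>m \<phi> \<in> w \<longleftrightarrow> (\<forall>v. E w v \<longrightarrow> \<phi> \<in> v)"
  using normal_modality_iff[of MAll, OF all_K nec_all] unfolding E_def by blast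

lemma ex_iff: "w \<in> W \<Longrightarrow> \<^bold>\<exists>\<^sub>m \<phi> \<in> w \<longleftrightarrow> (\<exists>v. E w v \<and> \<phi> \<in> v)"
  using E_W by (auto simp: all_iff)

lemma R_refl: "w \<in> W \<Longrightarrow> R w w"
  unfolding R_def using W_mp[OF box_T] by blast

lemma R_trans: "R w v \<Longrightarrow> R v u \<Longrightarrow> R w u"
  unfolding R_def using W_mp[OF box_4] by blast

lemma E_refl: "w \<in> W \<Longrightarrow> E w w"
  unfolding E_def using W_mp[OF all_T] by blast

lemma E_trans: "E w v \<Longrightarrow> E v u \<Longrightarrow> E w u"
  unfolding E_def using W_mp[OF all_4] by blast

lemma E_sym:
  assumes "E w v" shows "E v w"
proof -
  have W: "w \<in> W" "v \<in> W" using assms E_W by blast+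
  have "\<phi> \<in> w" if v: "\<^bold>\<forall>\<^sub>m \<phi> \<in> v" for \<phi>
  proof (rule ccontr)
    assume "\<phi> \<notin> w"
    then have "\<^bold>\<exists>\<^sub>m (\<^bold>\<not>\<^sub>m \<phi>) \<in> w"
      using W E_refl[OF W(1)] ex_iff[OF W(1)] by auto
    then have "\<^bold>\<exists>\<^sub>m (\<^bold>\<not>\<^sub>m \<phi>) \<in> v"
      using W_mp[OF all_5 W(1)] assms unfolding E_def by blast
    then show False
      using v W E_W by (auto simp: ex_iff[OF W(2)] all_iff[OF W(2)])
  qed
  then show ?thesis using W unfolding E_def by blast
qed

text \<open>The axiom \<open>\<box>\<forall>p \<rightarrow> \<forall>\<box>p\<close> enters in this form only.  It takes the place
  of the corresponding commutation of \<open>R\<close> and \<open>E\<close> in the canonical frame, whose proof would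
  require the construction of a further point.\<close>

lemma box_all_E:
  assumes "\<^bold>\<box>\<^sub>m (\<^bold>\<forall>\<^sub>m \<phi>) \<in> w" "E w v" shows "\<^bold>\<box>\<^sub>m (\<^bold>\<forall>\<^sub>m \<phi>) \<in> v"
proof -
  have w: "w \<in> W" using assms E_W by blast
  have "\<^bold>\<box>\<^sub>m (\<^bold>\<forall>\<^sub>m (\<^bold>\<forall>\<^sub>m \<phi>)) \<in> w"
    using assms(1) W_mp[OF all_4] R_W(2) by (auto simp: box_iff[OF w])
  then have "\<^bold>\<forall>\<^sub>m (\<^bold>\<box>\<^sub>m (\<^bold>\<forall>\<^sub>m \<phi>)) \<in> w"
    using W_mp[OF box_all w] by blast
  then show ?thesis using assms(2) all_iff[OF w] by blast
qed


section \<open>\<open>\<rho>\<close> produces extensions of \<open>MIPC\<close>\<close>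

text \<open>For translated formulas, membership in a point is intuitionistic forcing along \<open>R\<close>.  Here
  \<open>\<forall>\<close> looks along \<open>R\<close> and then \<open>E\<close>, whereas \<open>\<exists>\<close> looks along \<open>E\<close> only.\<close>

abbreviation forces :: "mform set \<Rightarrow> iform \<Rightarrow> bool" (infix \<open>\<tturnstile>\<close> 50) where
  "w \<tturnstile> \<phi> \<equiv> goedel \<phi> \<in> w"

lemma forces_imp: "w \<in> W \<Longrightarrow> w \<tturnstile> \<phi> \<^bold>\<rightarrow>\<^sub>i \<psi> \<longleftrightarrow> (\<forall>v. R w v \<longrightarrow> v \<tturnstile> \<phi> \<longrightarrow> v \<tturnstile> \<psi>)"
  using R_W(2) by (auto simp: box_iff)

lemma forces_impI:
  "w \<in> W \<Longrightarrow> (\<And>v. R w v \<Longrightarrow> v \<tturnstile> \<phi> \<Longrightarrow> v \<tturnstile> \<psi>) \<Longrightarrow> w \<tturnstile> \<phi> \<^bold>\<rightarrow>\<^sub>i \<psi>"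
  using forces_imp by blast

lemma forces_impD: "w \<tturnstile> \<phi> \<^bold>\<rightarrow>\<^sub>i \<psi> \<Longrightarrow> R w v \<Longrightarrow> v \<tturnstile> \<phi> \<Longrightarrow> v \<tturnstile> \<psi>"
  using forces_imp R_W(1) by blast

lemma forces_all: "w \<in> W \<Longrightarrow> w \<tturnstile> \<^bold>\<forall>\<^sub>i \<phi> \<longleftrightarrow> (\<forall>v u. R w v \<longrightarrow> E v u \<longrightarrow> u \<tturnstile> \<phi>)"
  using R_W(2) by (auto simp: box_iff all_iff)

lemma forces_ex: "w \<in> W \<Longrightarrow> w \<tturnstile> \<^bold>\<exists>\<^sub>i \<phi> \<longleftrightarrow> (\<exists>v. E w v \<and> v \<tturnstile> \<phi>)"
  using ex_iff by simp

text \<open>All cases but \<open>\<exists>\<close> are as in Kripke semantics for intuitionistic logic.  For \<open>\<exists>\<close>, let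
  \<open>u\<close> be a witness for \<open>w\<close>.  By induction every point above \<open>u\<close> forces \<open>\<phi>\<close>, so \<open>\<box>\<forall>\<exists>\<phi>\<^sup>t \<in> u\<close>; this
  moves along \<open>E\<close> to \<open>w\<close> and gives \<open>\<exists>\<phi>\<^sup>t\<close> everywhere above \<open>w\<close>.\<close>

lemma forces_mono: "w \<tturnstile> \<phi> \<Longrightarrow> R w v \<Longrightarrow> v \<tturnstile> \<phi>"
proof (induction \<phi> arbitrary: w v)
  case (IEx \<phi>)
  have w: "w \<in> W" and v: "v \<in> W" using IEx.prems R_W by blast+
  obtain u where u: "E w u" "u \<tturnstile> \<phi>" using IEx.prems forces_ex[OF w] by blast
  have uW: "u \<in> W" using u E_W by blast
  have "x \<tturnstile> \<^bold>\<exists>\<^sub>i \<phi>" if "R u y" "E y x" for x y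
    using IEx.IH[OF u(2) that(1)] that(2) E_sym E_W forces_ex by blast
  then have "\<^bold>\<box>\<^sub>m (\<^bold>\<forall>\<^sub>m (goedel (\<^bold>\<exists>\<^sub>i \<phi>))) \<in> u"
    using forces_all[OF uW, of "\<^bold>\<exists>\<^sub>i \<phi>"] by simp
  then have "\<^bold>\<box>\<^sub>m (\<^bold>\<forall>\<^sub>m (goedel (\<^bold>\<exists>\<^sub>i \<phi>))) \<in> w"
    using box_all_E E_sym[OF u(1)] by blast
  then show ?case
    using IEx.prems(2) E_refl[OF v] forces_all[OF w, of "\<^bold>\<exists>\<^sub>i \<phi>"] by simp
next
  case (IVar n)
  then show ?case using R_W R_trans by (auto simp: box_iff)
next
  case (IImp \<phi> \<psi>)
  show ?case
    by (rule forces_impI)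
      (use IImp.prems R_W(2) R_trans forces_impD in blast)+
next
  case (IAll \<phi>)
  have "w \<in> W" "v \<in> W" using IAll.prems R_W by blast+
  then show ?case using IAll.prems R_trans by (meson forces_all)
next
  case IBot
  then show ?case using R_W by auto
next
  case (IAnd \<phi> \<psi>)
  then show ?case using R_W by auto
next
  case (IOr \<phi> \<psi>)
  then show ?case using R_W by auto
qed

lemma goedel_box: "w \<in> W \<Longrightarrow> \<^bold>\<box>\<^sub>m (goedel \<phi>) \<in> w \<longleftrightarrow> w \<tturnstile> \<phi>"
  using box_iff R_refl forces_mono by blast

lemma forces_all_E: "w \<tturnstile> \<^bold>\<forall>\<^sub>i \<phi> \<Longrightarrow> E w v \<Longrightarrow> v \<tturnstile> \<^bold>\<forall>\<^sub>i \<phi>"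
  using box_all_E by simp

lemma forces_ex_E: "w \<in> W \<Longrightarrow> w \<tturnstile> \<^bold>\<exists>\<^sub>i \<phi> \<Longrightarrow> E w v \<Longrightarrow> v \<tturnstile> \<^bold>\<exists>\<^sub>i \<phi>"
  using forces_ex E_sym E_trans E_W by metis

text \<open>The translation commutes with substitution up to equivalence only: \<open>\<sigma>(p)\<^sup>t\<close> on the left
  stands against \<open>\<box>(\<sigma>(p)\<^sup>t)\<close> on the right, which persistence identifies.\<close>

lemma forces_isubst:
  "w \<in> W \<Longrightarrow> w \<tturnstile> isubst \<sigma> \<phi> \<longleftrightarrow> msubst (\<lambda>n. goedel (\<sigma> n)) (goedel \<phi>) \<in> w"
proof (induction \<phi> arbitrary: w)
  case (IVar n)
  then show ?case using goedel_box by simp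
next
  case (IImp \<phi> \<psi>)
  then show ?case using R_W(2) by (auto simp: box_iff)
next
  case (IAll \<phi>)
  then show ?case using R_W(2) E_W(2) by (auto simp: box_iff all_iff)
next
  case (IEx \<phi>)
  then show ?case using E_W(2) by (auto simp: all_iff)
qed simp_all

lemma iclosed_rho: "iclosed (rho M)"
  unfolding iclosed_def rho_def mem_Collect_eq
proof (intro conjI allI impI)
  fix \<phi> \<psi> assume "goedel \<phi> \<in> M" "goedel (\<phi> \<^bold>\<rightarrow>\<^sub>i \<psi>) \<in> M"
  then show "goedel \<psi> \<in> M"
    by (meson theoremI W_theorem forces_imp R_refl)
next
  fix \<phi> \<sigma> assume "goedel \<phi> \<in> M"
  then show "goedel (isubst \<sigma> \<phi>) \<in> M"
    using theoremI forces_isubst W_theorem subst by blast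
next
  fix \<phi> assume "goedel \<phi> \<in> M"
  then show "goedel (\<^bold>\<forall>\<^sub>i \<phi>) \<in> M" using nec_box nec_all by simp
qed

lemma forces_and: "w \<in> W \<Longrightarrow> w \<tturnstile> \<phi> \<^bold>\<and>\<^sub>i \<psi> \<longleftrightarrow> w \<tturnstile> \<phi> \<and> w \<tturnstile> \<psi>"
  and forces_or: "w \<in> W \<Longrightarrow> w \<tturnstile> \<phi> \<^bold>\<or>\<^sub>i \<psi> \<longleftrightarrow> w \<tturnstile> \<phi> \<or> w \<tturnstile> \<psi>"
  and forces_bot: "w \<in> W \<Longrightarrow> \<not> w \<tturnstile> \<^bold>\<bottom>\<^sub>i"
  by simp_all

lemma impI_theorem:
  assumes "\<And>w. w \<in> W \<Longrightarrow> w \<tturnstile> \<phi> \<Longrightarrow> w \<tturnstile> \<psi>" shows "\<phi> \<^bold>\<rightarrow>\<^sub>i \<psi> \<in> rho M"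
  unfolding rho_def mem_Collect_eq
  using theoremI forces_imp R_W(2) assms by blast

lemma iffI_theorem:
  assumes "\<And>w. w \<in> W \<Longrightarrow> w \<tturnstile> \<phi> \<longleftrightarrow> w \<tturnstile> \<psi>" shows "\<phi> \<^bold>\<leftrightarrow>\<^sub>i \<psi> \<in> rho M"
proof -
  have "\<phi> \<^bold>\<rightarrow>\<^sub>i \<psi> \<in> rho M" "\<psi> \<^bold>\<rightarrow>\<^sub>i \<phi> \<in> rho M"
    using assms by (auto intro: impI_theorem)
  then show ?thesis unfolding rho_def mem_Collect_eq
    using theoremI W_theorem forces_and by blast
qed

lemma IPC_subset_rho: "IPC \<subseteq> rho M"
proof
  fix \<phi> assume "\<phi> \<in> IPC"
  then show "\<phi> \<in> rho M"
  proof induction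
    case (10 \<phi> \<psi>)
    then show ?case using iclosed_rho unfolding iclosed_def by blast
  next
    case (1 \<phi> \<psi>)
    show ?case by (intro impI_theorem forces_impI) (blast intro: forces_mono)+
  next
    case (2 \<phi> \<psi> \<chi>)
    have "u \<tturnstile> \<chi>"
      if "w \<tturnstile> \<phi> \<^bold>\<rightarrow>\<^sub>i \<psi> \<^bold>\<rightarrow>\<^sub>i \<chi>" "R w v" "v \<tturnstile> \<phi> \<^bold>\<rightarrow>\<^sub>i \<psi>" "R v u" "u \<tturnstile> \<phi>" for w v u
      using that forces_impD R_trans R_W(2) R_refl by meson
    then show ?case by (intro impI_theorem forces_impI) (blast intro: R_W(2))+
  next
    case (5 \<phi> \<psi>)
    show ?case
      by (intro impI_theorem forces_impI) (use forces_mono forces_and R_W(2) in blast)+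
  next
    case (8 \<phi> \<chi> \<psi>)
    have "u \<tturnstile> \<chi>"
      if "w \<tturnstile> \<phi> \<^bold>\<rightarrow>\<^sub>i \<chi>" "R w v" "v \<tturnstile> \<psi> \<^bold>\<rightarrow>\<^sub>i \<chi>" "R v u" "u \<tturnstile> \<phi> \<^bold>\<or>\<^sub>i \<psi>" for w v u
      using that forces_impD R_trans R_W(2) forces_or by meson
    then show ?case by (intro impI_theorem forces_impI) (blast intro: R_W(2))+
  qed (rule impI_theorem; simp)+
qed

lemma MIPC_axioms_subset_rho: "MIPC_axioms \<subseteq> rho M"
proof -
  have 1: "\<^bold>\<forall>\<^sub>i (\<phi> \<^bold>\<and>\<^sub>i \<psi>) \<^bold>\<leftrightarrow>\<^sub>i (\<^bold>\<forall>\<^sub>i \<phi> \<^bold>\<and>\<^sub>i \<^bold>\<forall>\<^sub>i \<psi>) \<in> rho M" for \<phi> \<psi>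
    by (rule iffI_theorem) (metis forces_all forces_and E_W(2))
  have 2: "\<^bold>\<forall>\<^sub>i \<phi> \<^bold>\<rightarrow>\<^sub>i \<phi> \<in> rho M" for \<phi>
    by (rule impI_theorem) (metis forces_all R_refl E_refl)
  have 3: "\<^bold>\<forall>\<^sub>i \<phi> \<^bold>\<rightarrow>\<^sub>i \<^bold>\<forall>\<^sub>i (\<^bold>\<forall>\<^sub>i \<phi>) \<in> rho M" for \<phi>
    by (rule impI_theorem) (metis forces_all[of _ "\<^bold>\<forall>\<^sub>i \<phi>"] forces_mono forces_all_E)
  have 4: "\<^bold>\<exists>\<^sub>i (\<phi> \<^bold>\<or>\<^sub>i \<psi>) \<^bold>\<leftrightarrow>\<^sub>i (\<^bold>\<exists>\<^sub>i \<phi> \<^bold>\<or>\<^sub>i \<^bold>\<exists>\<^sub>i \<psi>) \<in> rho M" for \<phi> \<psi>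
    by (rule iffI_theorem) (metis forces_ex forces_or E_W(2))
  have 5: "\<phi> \<^bold>\<rightarrow>\<^sub>i \<^bold>\<exists>\<^sub>i \<phi> \<in> rho M" for \<phi>
    by (rule impI_theorem) (metis forces_ex E_refl)
  have 6: "\<^bold>\<exists>\<^sub>i (\<^bold>\<exists>\<^sub>i \<phi>) \<^bold>\<rightarrow>\<^sub>i \<^bold>\<exists>\<^sub>i \<phi> \<in> rho M" for \<phi>
    by (rule impI_theorem) (metis forces_ex E_trans E_W(2))
  have 7: "(\<^bold>\<exists>\<^sub>i \<phi> \<^bold>\<and>\<^sub>i \<^bold>\<exists>\<^sub>i \<psi>) \<^bold>\<rightarrow>\<^sub>i \<^bold>\<exists>\<^sub>i (\<^bold>\<exists>\<^sub>i \<phi> \<^bold>\<and>\<^sub>i \<psi>) \<in> rho M" for \<phi> \<psi>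
    by (rule impI_theorem) (metis forces_ex[of _ \<psi>] forces_ex[of _ "\<^bold>\<exists>\<^sub>i \<phi> \<^bold>\<and>\<^sub>i \<psi>"]
        forces_ex_E forces_and E_W(2))
  have 8: "\<^bold>\<exists>\<^sub>i (\<^bold>\<forall>\<^sub>i \<phi>) \<^bold>\<leftrightarrow>\<^sub>i \<^bold>\<forall>\<^sub>i \<phi> \<in> rho M" for \<phi>
    by (rule iffI_theorem) (metis forces_ex[of _ "\<^bold>\<forall>\<^sub>i \<phi>"] forces_all_E E_refl E_sym)
  have 9: "\<^bold>\<exists>\<^sub>i \<phi> \<^bold>\<leftrightarrow>\<^sub>i \<^bold>\<forall>\<^sub>i (\<^bold>\<exists>\<^sub>i \<phi>) \<in> rho M" for \<phi>
    by (rule iffI_theorem) (metis forces_all[of _ "\<^bold>\<exists>\<^sub>i \<phi>"] forces_mono forces_ex_E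
        R_W(2) R_refl E_refl)
  show ?thesis
    unfolding MIPC_axioms_def Let_def insert_subset
    by (intro conjI empty_subsetI 1 2 3 4 5 6 7 8 9)
qed

lemma rho_extension: "rho M \<in> carrier Ext_MIPC"
  unfolding Ext_MIPC_def MIPC_def
  using IPC_subset_rho MIPC_axioms_subset_rho iclosed_rho by auto

end

lemma rho_carrier: "M \<in> carrier Ext_MS4 \<Longrightarrow> rho M \<in> carrier Ext_MIPC"
  by (rule MS4_extension.rho_extension) (simp add: MS4_extension_def Ext_MS4_def)


section \<open>Kripke frames and their logics\<close>

primrec msat :: "('w \<Rightarrow> 'w \<Rightarrow> bool) \<Rightarrow> ('w \<Rightarrow> 'w \<Rightarrow> bool) \<Rightarrow> (nat \<Rightarrow> 'w \<Rightarrow> bool) \<Rightarrow> mform \<Rightarrow> 'w \<Rightarrow> bool" where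
  "msat R E V (MVar n) x \<longleftrightarrow> V n x"
| "msat R E V \<^bold>\<bottom>\<^sub>m x \<longleftrightarrow> False"
| "msat R E V (\<phi> \<^bold>\<and>\<^sub>m \<psi>) x \<longleftrightarrow> msat R E V \<phi> x \<and> msat R E V \<psi> x"
| "msat R E V (\<phi> \<^bold>\<or>\<^sub>m \<psi>) x \<longleftrightarrow> msat R E V \<phi> x \<or> msat R E V \<psi> x"
| "msat R E V (\<phi> \<^bold>\<rightarrow>\<^sub>m \<psi>) x \<longleftrightarrow> (msat R E V \<phi> x \<longrightarrow> msat R E V \<psi> x)"
| "msat R E V (\<^bold>\<box>\<^sub>m \<phi>) x \<longleftrightarrow> (\<forall>y. R x y \<longrightarrow> msat R E V \<phi> y)"
| "msat R E V (\<^bold>\<forall>\<^sub>m \<phi>) x \<longleftrightarrow> (\<forall>y. E x y \<longrightarrow> msat R E V \<phi> y)"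

definition frame_logic :: "('w \<Rightarrow> 'w \<Rightarrow> bool) \<Rightarrow> ('w \<Rightarrow> 'w \<Rightarrow> bool) \<Rightarrow> mform set" where
  "frame_logic R E = {\<phi>. \<forall>V x. msat R E V \<phi> x}"

lemma frame_logicI: "(\<And>V x. msat R E V \<phi> x) \<Longrightarrow> \<phi> \<in> frame_logic R E"
  and frame_logicD: "\<phi> \<in> frame_logic R E \<Longrightarrow> msat R E V \<phi> x"
  unfolding frame_logic_def by blast+

lemma msat_msubst:
  "msat R E V (msubst \<sigma> \<phi>) x = msat R E (\<lambda>n. msat R E V (\<sigma> n)) \<phi> x"
  by (induction \<phi> arbitrary: x) simp_all

locale MS4_frame =
  fixes R E :: "'w \<Rightarrow> 'w \<Rightarrow> bool"
  assumes R_refl: "R x x"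
    and R_trans: "R x y \<Longrightarrow> R y z \<Longrightarrow> R x z"
    and E_refl: "E x x"
    and E_sym: "E x y \<Longrightarrow> E y x"
    and E_trans: "E x y \<Longrightarrow> E y z \<Longrightarrow> E x z"
    and E_R_commute: "E x y \<Longrightarrow> R y z \<Longrightarrow> \<exists>u. R x u \<and> E u z"
begin

lemma frame_logic_extension: "frame_logic R E \<in> carrier Ext_MS4"
proof -
  have cl: "mclosed (frame_logic R E)"
    unfolding mclosed_def
  proof (intro conjI allI impI)
    fix \<phi> \<psi> assume "\<phi> \<in> frame_logic R E" "\<phi> \<^bold>\<rightarrow>\<^sub>m \<psi> \<in> frame_logic R E"
    then have "msat R E V (\<phi> \<^bold>\<rightarrow>\<^sub>m \<psi>) x" "msat R E V \<phi> x" for V x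
      by (blast dest: frame_logicD)+
    then show "\<psi> \<in> frame_logic R E" by (intro frame_logicI) simp
  qed (auto intro!: frame_logicI simp: msat_msubst dest: frame_logicD)
  have "\<phi> \<in> frame_logic R E" if "\<phi> \<in> CPC" for \<phi>
    using that
  proof induction
    case (10 \<phi> \<psi>)
    then show ?case using cl unfolding mclosed_def by blast
  qed (auto intro!: frame_logicI)
  moreover have "MS4_axioms \<subseteq> frame_logic R E"
    unfolding MS4_axioms_def S4_box_axioms_def S5_all_axioms_def Let_def
    by (auto intro!: frame_logicI)
      (meson R_refl R_trans E_refl E_trans E_sym E_R_commute)+
  ultimately show ?thesis
    using cl unfolding Ext_MS4_def MS4_def by auto
qed

end

lemma msat_box_mono:
  assumes "MS4_frame R E" "msat R E V (\<^bold>\<box>\<^sub>m \<phi>) x" "R x y"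
  shows "msat R E V (\<^bold>\<box>\<^sub>m \<phi>) y"
proof -
  have "R x z" if "R y z" for z
    using assms(1,3) that by (rule MS4_frame.R_trans)
  then show ?thesis using assms(2) by simp
qed

text \<open>Translated formulas denote up-sets: either they begin with \<open>\<box>\<close>, or, for \<open>\<exists>\<close>, a witness can be
  carried upwards because \<open>R\<close> and \<open>E\<close> commute.\<close>

lemma msat_goedel_mono:
  assumes "MS4_frame R E" "msat R E V (goedel \<phi>) x" "R x y"
  shows "msat R E V (goedel \<phi>) y"
  using assms(2,3)
proof (induction \<phi> arbitrary: x y)
  case (IEx \<phi>)
  interpret MS4_frame R E by fact
  obtain z where z: "E x z" "msat R E V (goedel \<phi>) z" using IEx.prems(1) by auto
  obtain u where "R z u" "E u y" using E_R_commute[OF E_sym[OF z(1)] IEx.prems(2)] by blast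
  then show ?case using IEx.IH[OF z(2)] E_sym by auto
next
  case (IAnd \<phi> \<psi>)
  then show ?case by auto
next
  case (IOr \<phi> \<psi>)
  then show ?case by auto
qed (use msat_box_mono[OF assms(1)] in \<open>simp_all only: goedel.simps msat.simps(2)\<close>)

text \<open>
  Maps that preserve the truth of translated formulas but possibly not of other modal formulas.
  By \<open>f_R\<close> such a map only identifies points within a cluster.  A p-morphism would have to
  lift \<open>E'\<close> to \<open>E\<close> exactly.  Two weaker conditions suffice, matched to how the
  translation quantifies: \<open>\<exists>\<close> is evaluated on up-sets, so a lift of \<open>u\<close> may land
  above \<open>u\<close>; \<open>\<forall>\<close> is preceded by \<open>\<box>\<close>, so a lift may first move along \<open>R\<close>.
\<close>

locale skeleton_morphism =
  S: MS4_frame R E + S': MS4_frame R' E'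
  for R E :: "'w \<Rightarrow> 'w \<Rightarrow> bool" and R' E' :: "'v \<Rightarrow> 'v \<Rightarrow> bool" +
  fixes f :: "'w \<Rightarrow> 'v"
  assumes f_surj: "surj f"
    and f_R: "R' (f x) (f y) \<longleftrightarrow> R x y"
    and f_E: "E x y \<Longrightarrow> E' (f x) (f y)"
    and f_E_above: "E' (f x) u \<Longrightarrow> \<exists>y. E x y \<and> R' u (f y)"
    and f_RE_back: "E' (f x) u \<Longrightarrow> \<exists>z y. R x z \<and> E z y \<and> f y = u"
begin

lemma msat_goedel:
  assumes V: "\<And>n x. msat R E V (\<^bold>\<box>\<^sub>m (MVar n)) x = msat R' E' V' (\<^bold>\<box>\<^sub>m (MVar n)) (f x)"
  shows "msat R E V (goedel \<phi>) x = msat R' E' V' (goedel \<phi>) (f x)"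
proof (induction \<phi> arbitrary: x)
  case (IVar n)
  then show ?case using V by simp
next
  case (IImp \<phi> \<psi>)
  have "(\<forall>u. R' (f x) u \<longrightarrow> P u) \<longleftrightarrow> (\<forall>y. R x y \<longrightarrow> P (f y))" for P
    using f_R f_surj by (metis surjD)
  then show ?case using IImp by simp
next
  case (IAll \<phi>)
  have "(\<exists>u. R' (f x) u \<and> E' u v) \<longleftrightarrow> (\<exists>z y. R x z \<and> E z y \<and> f y = v)" for v
  proof
    assume "\<exists>u. R' (f x) u \<and> E' u v"
    then obtain z where "R x z" "E' (f z) v" using f_R f_surj by (metis surjD)
    then show "\<exists>z y. R x z \<and> E z y \<and> f y = v" using f_RE_back S.R_trans by blast
  qed (use f_R f_E in blast)
  then show ?case using IAll by simp metis
next
  case (IEx \<phi>)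
  have "(\<exists>u. E' (f x) u \<and> msat R' E' V' (goedel \<phi>) u)
      \<longleftrightarrow> (\<exists>y. E x y \<and> msat R' E' V' (goedel \<phi>) (f y))"
    using f_E f_E_above msat_goedel_mono[OF S'.MS4_frame_axioms] by meson
  then show ?case using IEx by simp
qed simp_all

lemma rho_frame_logic: "rho (frame_logic R E) = rho (frame_logic R' E')"
proof (intro equalityI subsetI)
  fix \<phi> assume \<phi>: "\<phi> \<in> rho (frame_logic R E)"
  have "msat R' E' V' (goedel \<phi>) u" for V' u
  proof -
    obtain x where "u = f x" using f_surj by (metis surjD)
    moreover have "msat R E (\<lambda>n x. V' n (f x)) (goedel \<phi>) x
        = msat R' E' V' (goedel \<phi>) (f x)"
      by (rule msat_goedel) (use f_R f_surj in \<open>simp, metis surjD\<close>)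
    ultimately show ?thesis using \<phi> unfolding rho_def frame_logic_def by blast
  qed
  then show "\<phi> \<in> rho (frame_logic R' E')" unfolding rho_def frame_logic_def by blast
next
  fix \<phi> assume \<phi>: "\<phi> \<in> rho (frame_logic R' E')"
  have "msat R E V (goedel \<phi>) x" for V x
  proof -
    \<comment> \<open>Only \<open>\<box>p\<close> matters for \<open>\<phi>\<^sup>t\<close>, so the letter \<open>p\<close> can be given the image of \<open>\<box>p\<close>, which is
      well defined since \<open>\<box>p\<close> is constant on clusters.\<close>
    let ?V' = "\<lambda>n u. \<forall>y. R' u (f y) \<longrightarrow> V n y"
    have "msat R E V (goedel \<phi>) x = msat R' E' ?V' (goedel \<phi>) (f x)"
      by (rule msat_goedel) (use f_R S'.R_refl S'.R_trans in \<open>simp, meson\<close>)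
    then show ?thesis using \<phi> unfolding rho_def frame_logic_def by blast
  qed
  then show "\<phi> \<in> rho (frame_logic R E)" unfolding rho_def frame_logic_def by blast
qed

end


section \<open>Two frames with the same skeleton\<close>

abbreviation chain_R :: "bool \<Rightarrow> bool \<Rightarrow> bool" where
  "chain_R \<equiv> (\<le>)"

abbreviation chain_E :: "bool \<Rightarrow> bool \<Rightarrow> bool" where
  "chain_E \<equiv> (\<lambda>_ _. True)"

text \<open>The points \<open>Tied\<close> and \<open>Free\<close> form a cluster above \<open>Root\<close>, and \<open>E\<close> has the classes
  \<open>{Root, Tied}\<close> and \<open>{Free}\<close>.\<close>

datatype doubled = Root | Tied | Free

definition doubled_R :: "doubled \<Rightarrow> doubled \<Rightarrow> bool" where
  "doubled_R x y \<longleftrightarrow> (y = Root \<longrightarrow> x = Root)"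

definition doubled_E :: "doubled \<Rightarrow> doubled \<Rightarrow> bool" where
  "doubled_E x y \<longleftrightarrow> (x = Free \<longleftrightarrow> y = Free)"

interpretation chain: MS4_frame chain_R chain_E
  by unfold_locales auto

text \<open>Identifying \<open>Tied\<close> and \<open>Free\<close> is not a p-morphism for \<open>E\<close>, because \<open>Free\<close> is not
  \<open>E\<close>-equivalent to \<open>Root\<close>.  The weaker conditions hold: \<open>Free\<close> itself lies above the root of the
  chain, and from \<open>Free\<close> the root is reached by an \<open>R\<close>-step to \<open>Tied\<close> followed by an
  \<open>E\<close>-step.\<close>

interpretation collapse: skeleton_morphism doubled_R doubled_E chain_R chain_E "\<lambda>x. x \<noteq> Root"
proof unfold_locales
  show "surj (\<lambda>x. x \<noteq> Root)"
    unfolding surj_def by (metis doubled.distinct(1))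
  fix x u
  show "\<exists>y. doubled_E x y \<and> u \<le> (y \<noteq> Root)"
    by (cases x) (auto simp: doubled_E_def)
  show "\<exists>z y. doubled_R x z \<and> doubled_E z y \<and> (y \<noteq> Root) = u"
    unfolding doubled_R_def doubled_E_def
    by (rule exI[of _ Tied], rule exI[of _ "if u then Tied else Root"]) auto
next
  fix x y z
  assume "doubled_E x y" "doubled_R y z"
  then show "\<exists>u. doubled_R x u \<and> doubled_E u z"
    unfolding doubled_R_def doubled_E_def
    by (intro exI[of _ "if z = Free then Free else Tied"]) auto
qed (auto simp: doubled_R_def doubled_E_def)

abbreviation "chain_logic \<equiv> frame_logic chain_R chain_E"
abbreviation "doubled_logic \<equiv> frame_logic doubled_R doubled_E"

lemma all_box_chain: "\<^bold>\<forall>\<^sub>m \<phi> \<^bold>\<rightarrow>\<^sub>m \<^bold>\<box>\<^sub>m \<phi> \<in> chain_logic"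
  by (rule frame_logicI) simp

lemma all_box_not_doubled: "\<^bold>\<forall>\<^sub>m (MVar 0) \<^bold>\<rightarrow>\<^sub>m \<^bold>\<box>\<^sub>m (MVar 0) \<notin> doubled_logic"
proof -
  have "\<not> msat doubled_R doubled_E (\<lambda>_ x. x \<noteq> Free)
      (\<^bold>\<forall>\<^sub>m (MVar 0) \<^bold>\<rightarrow>\<^sub>m \<^bold>\<box>\<^sub>m (MVar 0)) Root"
    by (auto simp: doubled_R_def doubled_E_def)
  then show ?thesis unfolding frame_logic_def by blast
qed

lemma dia_all_doubled: "\<^bold>\<not>\<^sub>m (\<^bold>\<box>\<^sub>m (\<^bold>\<not>\<^sub>m (\<phi> \<^bold>\<rightarrow>\<^sub>m \<^bold>\<forall>\<^sub>m \<phi>))) \<in> doubled_logic"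
proof (rule frame_logicI)
  fix V x
  have "msat doubled_R doubled_E V (\<phi> \<^bold>\<rightarrow>\<^sub>m \<^bold>\<forall>\<^sub>m \<phi>) Free"
    by (simp add: doubled_E_def)
  moreover have "doubled_R x Free" by (simp add: doubled_R_def)
  ultimately show "msat doubled_R doubled_E V (\<^bold>\<not>\<^sub>m (\<^bold>\<box>\<^sub>m (\<^bold>\<not>\<^sub>m (\<phi> \<^bold>\<rightarrow>\<^sub>m \<^bold>\<forall>\<^sub>m \<phi>)))) x"
    unfolding msat.simps by blast
qed

text \<open>At the bottom of the chain, refuted by the letter that holds exactly at the top.\<close>

lemma excluded_middle_not_chain: "IVar 0 \<^bold>\<or>\<^sub>i (IVar 0 \<^bold>\<rightarrow>\<^sub>i \<^bold>\<bottom>\<^sub>i) \<notin> rho chain_logic"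
proof -
  have "\<not> msat chain_R chain_E (\<lambda>_ x. x) (goedel (IVar 0 \<^bold>\<or>\<^sub>i (IVar 0 \<^bold>\<rightarrow>\<^sub>i \<^bold>\<bottom>\<^sub>i))) False"
    by auto
  then show ?thesis unfolding rho_def frame_logic_def by blast
qed

text \<open>
  The first schema says \<open>R \<subseteq> E\<close> in the canonical frame.  If \<open>w\<close> forces \<open>\<phi>\<close>, the second schema gives some
  \<open>u\<close> above \<open>w\<close> at which \<open>\<phi>\<^sup>t \<rightarrow> \<forall>\<phi>\<^sup>t\<close> holds; \<open>u\<close> forces \<open>\<phi>\<close> by persistence, so
  \<open>\<phi>\<close> is forced on the whole \<open>E\<close>-class of \<open>u\<close>, which is that of \<open>w\<close>.  Forcing is therefore
  constant on \<open>E\<close>-classes, hence along \<open>R\<close> in both directions.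
\<close>

lemma (in MS4_extension) excluded_middle_rho:
  assumes all_box: "\<And>\<phi>. \<^bold>\<forall>\<^sub>m \<phi> \<^bold>\<rightarrow>\<^sub>m \<^bold>\<box>\<^sub>m \<phi> \<in> M"
    and dia_all: "\<And>\<phi>. \<^bold>\<not>\<^sub>m (\<^bold>\<box>\<^sub>m (\<^bold>\<not>\<^sub>m (\<phi> \<^bold>\<rightarrow>\<^sub>m \<^bold>\<forall>\<^sub>m \<phi>))) \<in> M"
  shows "\<phi> \<^bold>\<or>\<^sub>i (\<phi> \<^bold>\<rightarrow>\<^sub>i \<^bold>\<bottom>\<^sub>i) \<in> rho M"
proof -
  have R_E: "E w v" if "R w v" for w v
    using that W_mp[OF all_box] unfolding R_def E_def by blast
  have E_const: "v \<tturnstile> \<phi>" if "w \<tturnstile> \<phi>" "E w v" for w v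
  proof -
    have w: "w \<in> W" using that E_W by blast
    have "\<^bold>\<box>\<^sub>m (\<^bold>\<not>\<^sub>m (goedel \<phi> \<^bold>\<rightarrow>\<^sub>m \<^bold>\<forall>\<^sub>m (goedel \<phi>))) \<notin> w"
      using W_theorem[OF w dia_all] w by simp
    then obtain u where u: "R w u" "u \<tturnstile> \<phi> \<longrightarrow> \<^bold>\<forall>\<^sub>m (goedel \<phi>) \<in> u"
      using R_W(2) by (auto simp: box_iff[OF w])
    then have "\<^bold>\<forall>\<^sub>m (goedel \<phi>) \<in> u" using forces_mono that(1) by blast
    then show ?thesis
      using E_trans[OF E_sym[OF R_E[OF u(1)]] that(2)] unfolding E_def by blast
  qed
  have "w \<tturnstile> \<phi> \<^bold>\<or>\<^sub>i (\<phi> \<^bold>\<rightarrow>\<^sub>i \<^bold>\<bottom>\<^sub>i)" if w: "w \<in> W" for w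
    using E_const[OF _ E_sym[OF R_E]] forces_impI[OF w] forces_or[OF w] by blast
  then show ?thesis unfolding rho_def mem_Collect_eq by (rule theoremI)
qed

theorem corollary6p19:
  shows "rho \<in> carrier Ext_MS4 \<rightarrow> carrier Ext_MIPC
    \<and> \<not> lattice_hom Ext_MS4 Ext_MIPC rho
    \<and> \<not> inj_on rho (carrier Ext_MS4)"
proof (intro conjI)
  show "rho \<in> carrier Ext_MS4 \<rightarrow> carrier Ext_MIPC"
    using rho_carrier by blast
  note logics = chain.frame_logic_extension collapse.S.frame_logic_extension
  have same: "rho doubled_logic = rho chain_logic"
    by (rule collapse.rho_frame_logic)
  show "\<not> inj_on rho (carrier Ext_MS4)"
    using same logics all_box_chain all_box_not_doubled unfolding inj_on_def by metis
  show "\<not> lattice_hom Ext_MS4 Ext_MIPC rho"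
  proof
    assume "lattice_hom Ext_MS4 Ext_MIPC rho"
    then have pres: "rho (chain_logic \<squnion>\<^bsub>Ext_MS4\<^esub> doubled_logic)
        = rho chain_logic \<squnion>\<^bsub>Ext_MIPC\<^esub> rho doubled_logic"
      using logics unfolding lattice_hom_def join_pres_def by blast
    interpret X: complete_lattice Ext_MS4 by (rule complete_lattice_Ext_MS4)
    interpret Y: complete_lattice Ext_MIPC by (rule complete_lattice_Ext_MIPC)
    let ?J = "chain_logic \<squnion>\<^bsub>Ext_MS4\<^esub> doubled_logic"
    have J: "?J \<in> carrier Ext_MS4" "chain_logic \<subseteq> ?J" "doubled_logic \<subseteq> ?J"
      using logics X.join_closed X.join_left X.join_right by (auto simp: Ext_MS4_def)
    interpret J: MS4_extension ?J
      using J(1) by unfold_locales (auto simp: Ext_MS4_def)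
    have "IVar 0 \<^bold>\<or>\<^sub>i (IVar 0 \<^bold>\<rightarrow>\<^sub>i \<^bold>\<bottom>\<^sub>i) \<in> rho ?J"
      using J.excluded_middle_rho J(2,3) all_box_chain dia_all_doubled by blast
    moreover have "rho chain_logic \<squnion>\<^bsub>Ext_MIPC\<^esub> rho doubled_logic = rho chain_logic"
    proof -
      have "rho chain_logic \<in> carrier Ext_MIPC" using rho_carrier logics by blast
      then have "rho chain_logic \<squnion>\<^bsub>Ext_MIPC\<^esub> rho chain_logic = rho chain_logic"
        using Y.join_le[of "rho chain_logic" "rho chain_logic" "rho chain_logic"]
          Y.join_left[of "rho chain_logic" "rho chain_logic"]
        by (auto simp: Ext_MIPC_def)
      then show ?thesis using same by simp
    qed
    ultimately show False using pres excluded_middle_not_chain by simp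
  qed
qed

end
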